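(* Let $R$ be an integral domain with quotient field $K$ and let $I$ be a strongly primary ideal of $R$. Then $I$ is a strongly 2-absorbing primary ideal of $R$.
   Context: Let $R$ be an integral domain with quotient field $K$. A proper ideal $I$ of $R$ is strongly primary if, whenever $xy\in I$ for elements $x,y\in K$, then $x\in I$ or $y^n\in I$ for some $n\geq 1$. An ideal $I$ of $R$ is a strongly 2-absorbing primary ideal if, whenever $xyz\in I$ for elements $x,y,z\in K$, we have either $xy\in I$ or $(yz)^n\in I$ or $(xz)^m\in I$ for some positive integers $n,m$. *)

theory Defs
  imports "HOL-Algebra.Algebra"
begin

text \<open>
  An integral domain is treated as a subset \<open>R\<close> of the carrier of its quotient field \<open>K\<close>, so that
  for \<open>x\<close> and \<open>y\<close> in \<open>K\<close> the condition \<open>x \<otimes> y \<in> I\<close> makes sense without an embedding map.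
  Ideals of \<open>R\<close> are ideals of the ring \<open>K\<lparr>carrier := R\<rparr>\<close>, not of \<open>K\<close>.
\<close>

definition quotient_field_of :: "('a, 'b) ring_scheme \<Rightarrow> 'a set \<Rightarrow> bool" where
  "quotient_field_of K R \<longleftrightarrow>
     field K \<and> subdomain R K \<and>
     (\<forall>x \<in> carrier K. \<exists>a \<in> R. \<exists>b \<in> R - {\<zero>\<^bsub>K\<^esub>}. x = a \<otimes>\<^bsub>K\<^esub> inv\<^bsub>K\<^esub> b)"

definition strongly_primary_ideal :: "('a, 'b) ring_scheme \<Rightarrow> 'a set \<Rightarrow> 'a set \<Rightarrow> bool" where
  "strongly_primary_ideal K R I \<longleftrightarrow>
     ideal I (K\<lparr>carrier := R\<rparr>) \<and> I \<noteq> R \<and>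
     (\<forall>x \<in> carrier K. \<forall>y \<in> carrier K.
        x \<otimes>\<^bsub>K\<^esub> y \<in> I \<longrightarrow> x \<in> I \<or> (\<exists>n::nat. n \<ge> 1 \<and> y [^]\<^bsub>K\<^esub> n \<in> I))"

text \<open>Unlike a strongly primary ideal, this one is not required to be proper.\<close>

definition strongly_2_absorbing_primary_ideal ::
    "('a, 'b) ring_scheme \<Rightarrow> 'a set \<Rightarrow> 'a set \<Rightarrow> bool" where
  "strongly_2_absorbing_primary_ideal K R I \<longleftrightarrow>
     ideal I (K\<lparr>carrier := R\<rparr>) \<and>
     (\<forall>x \<in> carrier K. \<forall>y \<in> carrier K. \<forall>z \<in> carrier K.
        x \<otimes>\<^bsub>K\<^esub> y \<otimes>\<^bsub>K\<^esub> z \<in> I \<longrightarrow>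
          x \<otimes>\<^bsub>K\<^esub> y \<in> I \<or>
          (\<exists>n::nat. n \<ge> 1 \<and> (y \<otimes>\<^bsub>K\<^esub> z) [^]\<^bsub>K\<^esub> n \<in> I) \<or>
          (\<exists>m::nat. m \<ge> 1 \<and> (x \<otimes>\<^bsub>K\<^esub> z) [^]\<^bsub>K\<^esub> m \<in> I))"

end

theory Submission
  imports Defs
begin

text \<open>
  Split \<open>xyz\<close> as \<open>x(yz)\<close> and as \<open>y(xz)\<close>: unless a power of \<open>yz\<close> or of \<open>xz\<close> lies in \<open>I\<close>, both
  \<open>x\<close> and \<open>y\<close> lie in \<open>I\<close>, and then so does \<open>xy\<close>.
\<close>

theorem proposition2p2:
  fixes K :: "('a, 'b) ring_scheme" and R I :: "'a set"
  assumes "quotient_field_of K R"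
    and "strongly_primary_ideal K R I"
  shows "strongly_2_absorbing_primary_ideal K R I"
proof -
  interpret field K
    using assms(1) by (simp add: quotient_field_of_def)
  have I: "ideal I (K\<lparr>carrier := R\<rparr>)"
    and primary: "\<And>x y. \<lbrakk>x \<in> carrier K; y \<in> carrier K; x \<otimes>\<^bsub>K\<^esub> y \<in> I\<rbrakk>
      \<Longrightarrow> x \<in> I \<or> (\<exists>n::nat. n \<ge> 1 \<and> y [^]\<^bsub>K\<^esub> n \<in> I)"
    using assms(2) by (auto simp: strongly_primary_ideal_def)
  \<comment> \<open>Absorption applies because \<open>x\<close>, as an element of \<open>I\<close>,
    also lies in \<open>R\<close>; the product of \<open>K\<lparr>carrier := R\<rparr>\<close> is
    that of \<open>K\<close>.\<close>
  have mult: "x \<otimes>\<^bsub>K\<^esub> y \<in> I" if "x \<in> I" "y \<in> I" for x y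
    using ideal.I_l_closed[OF I that(2)] ideal.Icarr[OF I that(1)] by simp
  show ?thesis
    unfolding strongly_2_absorbing_primary_ideal_def
  proof (intro conjI ballI impI)
    fix x y z
    assume carr: "x \<in> carrier K" "y \<in> carrier K" "z \<in> carrier K"
      and xyz: "x \<otimes>\<^bsub>K\<^esub> y \<otimes>\<^bsub>K\<^esub> z \<in> I"
    \<comment> \<open>The condition \<open>primary\<close> is asymmetric: only the right factor is
      raised to a power. Hence the products with \<open>z\<close> stand on the right, and
      \<open>x\<close> and \<open>y\<close> alone on the left.\<close>
    have xyz': "x \<otimes>\<^bsub>K\<^esub> (y \<otimes>\<^bsub>K\<^esub> z) \<in> I" "y \<otimes>\<^bsub>K\<^esub> (x \<otimes>\<^bsub>K\<^esub> z) \<in> I"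
      using xyz carr by (simp_all add: m_assoc m_lcomm)
    have "x \<in> I \<or> (\<exists>n::nat. n \<ge> 1 \<and> (y \<otimes>\<^bsub>K\<^esub> z) [^]\<^bsub>K\<^esub> n \<in> I)"
      by (rule primary[OF carr(1) m_closed[OF carr(2,3)] xyz'(1)])
    moreover have "y \<in> I \<or> (\<exists>m::nat. m \<ge> 1 \<and> (x \<otimes>\<^bsub>K\<^esub> z) [^]\<^bsub>K\<^esub> m \<in> I)"
      by (rule primary[OF carr(2) m_closed[OF carr(1,3)] xyz'(2)])
    ultimately show "x \<otimes>\<^bsub>K\<^esub> y \<in> I \<or>
        (\<exists>n::nat. n \<ge> 1 \<and> (y \<otimes>\<^bsub>K\<^esub> z) [^]\<^bsub>K\<^esub> n \<in> I) \<or>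
        (\<exists>m::nat. m \<ge> 1 \<and> (x \<otimes>\<^bsub>K\<^esub> z) [^]\<^bsub>K\<^esub> m \<in> I)"
      using mult by blast
  qed (fact I)
qed

end
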